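(* Let $w_{1},w_{2},w_{3}$ be any odd positive integers and $n\ge0$ an integer. Then for all $y_1$ the following six expressions are equal: \begin{align*} &w_{1}^{n}\sum_{k=0}^{n}\binom{n}{k}\sum_{i=0}^{w_{1}-1}(-1)^iE_{k}\Big(w_{2}y_{1}+\frac{w_{2}}{w_{1}}i\Big)T_{n-k}(w_{3}-1)w_{2}^{n-k}w_{3}^{k}\\ =&w_{1}^{n}\sum_{k=0}^{n}\binom{n}{k}\sum_{i=0}^{w_{1}-1}(-1)^iE_{k}\Big(w_{3}y_{1}+\frac{w_{3}}{w_{1}}i\Big)T_{n-k}(w_{2}-1)w_{3}^{n-k}w_{2}^{k}\\ =&w_{2}^{n}\sum_{k=0}^{n}\binom{n}{k}\sum_{i=0}^{w_{2}-1}(-1)^iE_{k}\Big(w_{1}y_{1}+\frac{w_{1}}{w_{2}}i\Big)T_{n-k}(w_{3}-1)w_{1}^{n-k}w_{3}^{k}\\ =&w_{2}^{n}\sum_{k=0}^{n}\binom{n}{k}\sum_{i=0}^{w_{2}-1}(-1)^iE_{k}\Big(w_{3}y_{1}+\frac{w_{3}}{w_{2}}i\Big)T_{n-k}(w_{1}-1)w_{3}^{n-k}w_{1}^{k}\\ =&w_{3}^{n}\sum_{k=0}^{n}\binom{n}{k}\sum_{i=0}^{w_{3}-1}(-1)^iE_{k}\Big(w_{1}y_{1}+\frac{w_{1}}{w_{3}}i\Big)T_{n-k}(w_{2}-1)w_{1}^{n-k}w_{2}^{k}\\ =&w_{3}^{n}\sum_{k=0}^{n}\binom{n}{k}\sum_{i=0}^{w_{3}-1}(-1)^iE_{k}\Big(w_{2}y_{1}+\frac{w_{2}}{w_{3}}i\Big)T_{n-k}(w_{1}-1)w_{2}^{n-k}w_{1}^{k}.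 \end{align*}
   Context: The Euler polynomials $E_n(x)$ are defined by $\frac{2}{e^{t}+1}e^{xt}=\sum_{n=0}^{\infty}E_{n}(x)\frac{t^{n}}{n!}$. For integers $k,N\ge0$, $T_{k}(N)=\sum_{i=0}^{N}(-1)^{i}i^{k}$, with the convention $0^0=1$. *)

theory Defs
  imports "HOL-Computational_Algebra.Formal_Power_Series"
begin

text \<open>
  The Euler polynomials are read off their exponential generating function
  \<open>2 / (e\<^sup>t + 1) * e\<^sup>x\<^sup>t\<close>, taken as a formal power series in \<open>t\<close>. The denominator has
  constant coefficient \<open>2 \<noteq> 0\<close>, so it is a unit and the division is a genuine one. The
  argument \<open>x\<close> ranges over an arbitrary field of characteristic 0.
\<close>

definition euler_poly :: "nat \<Rightarrow> 'a::field_char_0 \<Rightarrow> 'a" where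
  "euler_poly n x = fact n * fps_nth (2 / (fps_exp 1 + 1) * fps_exp x) n"

lemma euler_poly_generating_function:
  fixes x :: "'a::field_char_0"
  shows "2 / (fps_exp 1 + 1) * fps_exp x = Abs_fps (\<lambda>n. euler_poly n x / fact n)"
  by (rule fps_ext) (simp add: euler_poly_def)

lemma euler_poly_generating_function_mult:
  fixes x :: "'a::field_char_0"
  shows "(fps_exp 1 + 1) * Abs_fps (\<lambda>n. euler_poly n x / fact n) = 2 * fps_exp x"
proof -
  have u: "fps_nth (fps_exp (1::'a) + 1) 0 \<noteq> 0"
    by simp
  have "(fps_exp (1::'a) + 1) * (2 / (fps_exp 1 + 1)) = 2"
    using u by (simp add: fps_divide_unit inverse_mult_eq_1' mult.left_commute)
  then show ?thesis
    unfolding euler_poly_generating_function [symmetric] by (simp add: mult.assoc [symmetric])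
qed

text \<open>The convention \<open>0\<^sup>0 = 1\<close> is that of the power operation.\<close>

definition alt_power_sum :: "nat \<Rightarrow> nat \<Rightarrow> 'a::comm_ring_1" where
  "alt_power_sum k N = (\<Sum>i=0..N. (-1) ^ i * of_nat i ^ k)"

end

theory Submission imports Defs begin

text \<open>
  Write \<open>(a, b, c)\<close> for \<open>(w\<^sub>1, w\<^sub>2, w\<^sub>3)\<close>. As \<open>a\<close> and \<open>c\<close> are odd, the alternating
  geometric sums of \<open>e\<^bsup>bct\<^esup>\<close> and \<open>e\<^bsup>abt\<^esup>\<close> over \<open>i < a\<close> and \<open>j < c\<close> are
  \<open>(e\<^bsup>abct\<^esup> + 1) / (e\<^bsup>bct\<^esup> + 1)\<close> and \<open>(e\<^bsup>abct\<^esup> + 1) / (e\<^bsup>abt\<^esup> + 1)\<close>. Hence the first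
  expression is \<open>n!\<close> times the \<open>n\<close>-th coefficient of
  \<open>2 e\<^bsup>abcyt\<^esup> (e\<^bsup>abct\<^esup> + 1)\<^sup>2 / ((e\<^bsup>bct\<^esup> + 1) (e\<^bsup>act\<^esup> + 1) (e\<^bsup>abt\<^esup> + 1))\<close>,
  which is symmetric in \<open>a\<close>, \<open>b\<close>, \<open>c\<close>; the other five expressions arise from the first by
  permuting the three weights.
\<close>

unbundle fps_syntax

text \<open>Substitute \<open>s * t\<close> for \<open>t\<close> in the generating function with its
  denominator cleared: \<open>fps_exp 1\<close> becomes \<open>fps_exp s\<close>, and the
  \<open>k\<close>-th coefficient gains \<open>s ^ k\<close>.\<close>

lemma euler_poly_generating_function_scaled:
  fixes s x :: "'a::field_char_0"
  shows "(fps_exp s + 1) * Abs_fps (\<lambda>k. s ^ k * (euler_poly k x / fact k)) = 2 * fps_exp (s * x)"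
proof -
  let ?L = "fps_const s * fps_X"
  have euler: "Abs_fps (\<lambda>k. euler_poly k x / fact k) oo ?L
      = Abs_fps (\<lambda>k. s ^ k * (euler_poly k x / fact k))"
    by (simp add: fps_compose_linear)
  have "((fps_exp 1 + 1) * Abs_fps (\<lambda>n. euler_poly n x / fact n)) oo ?L
      = (fps_const 2 * fps_exp x) oo ?L"
    by (simp only: euler_poly_generating_function_mult numeral_fps_const)
  then show ?thesis
    by (simp add: fps_compose_mult_distrib fps_compose_add_distrib euler numeral_fps_const
        del: times_divide_eq_right)
qed

text \<open>A finite geometric sum with ratio \<open>- fps_exp s\<close>; since \<open>m\<close> is
  odd, the end term \<open>- (- fps_exp s) ^ m\<close> is \<open>fps_exp s ^ m\<close>.\<close>

lemma fps_exp_alternating_sum: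
  fixes s :: "'a::field_char_0"
  assumes "odd m"
  shows "(fps_exp s + 1) * (\<Sum>i=0..m - 1. (-1) ^ i * fps_exp (of_nat i * s))
    = fps_exp (of_nat m * s) + 1"
proof -
  \<comment> \<open>Oddness excludes \<open>m = 0\<close>, where truncated subtraction would leave
    the index 0 in the left-hand range.\<close>
  have range: "{0..m - 1} = {..<m}"
    using odd_pos[OF assms] by auto
  have "(fps_exp s + 1) * (\<Sum>i<m. (- fps_exp s) ^ i) = 1 - (- fps_exp s) ^ m"
    using one_diff_power_eq[of "- fps_exp s" m] by (simp add: add.commute)
  also have "\<dots> = fps_exp (of_nat m * s) + 1"
    using assms by (simp add: fps_exp_power_mult)
  also have "(\<Sum>i<m. (- fps_exp s) ^ i) = (\<Sum>i<m. (-1) ^ i * fps_exp (of_nat i * s))"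
    by (simp add: power_minus[of "fps_exp s"] fps_exp_power_mult)
  finally show ?thesis
    by (simp only: range)
qed

lemma fps_nth_alternating_exp_sum:
  fixes s :: "'a::field_char_0"
  shows "(\<Sum>i=0..N. (-1) ^ i * fps_exp (of_nat i * s)) $ k = s ^ k * alt_power_sum k N / fact k"
proof -
  have "((-1) ^ i * fps_exp (of_nat i * s)) $ k = s ^ k * ((-1) ^ i * of_nat i ^ k) / fact k" for i
    by (cases "even i") (simp_all add: power_mult_distrib)
  then show ?thesis
    by (simp add: fps_sum_nth alt_power_sum_def sum_distrib_left sum_divide_distrib)
qed

text \<open>Each of the six expressions is a literal instance, one for each order of the
  weights.\<close>

definition weighted_euler_sum :: "nat \<Rightarrow> nat \<Rightarrow> nat \<Rightarrow> nat \<Rightarrow> 'a::field_char_0 \<Rightarrow> 'a" where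
  "weighted_euler_sum n a b c y = of_nat a ^ n * (\<Sum>k=0..n. of_nat (n choose k) *
     (\<Sum>i=0..a - 1. (-1) ^ i * euler_poly k (of_nat b * y + of_nat b / of_nat a * of_nat i)) *
     alt_power_sum (n - k) (c - 1) * of_nat b ^ (n - k) * of_nat c ^ k)"

text \<open>With the denominators cleared, the symmetry in the weights can be read off by
  commutativity alone.\<close>

lemma weighted_euler_sum_generating_function:
  fixes a b c :: nat and y :: "'a::field_char_0"
  assumes "odd a" "odd c"
  defines "A \<equiv> of_nat a" and "B \<equiv> of_nat b" and "C \<equiv> of_nat c"
  shows "(fps_exp (B * C) + 1) * (fps_exp (A * C) + 1) * (fps_exp (A * B) + 1) *
      Abs_fps (\<lambda>n. weighted_euler_sum n a b c y / fact n)
    = 2 * fps_exp (A * B * C * y) * (fps_exp (A * B * C) + 1)\<^sup>2"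
proof -
  have A: "A \<noteq> 0"
    using odd_pos[OF assms(1)] by (simp add: A_def)
  let ?x = "\<lambda>i. B * y + B / A * of_nat i"
  \<comment> \<open>\<open>U\<close> carries the Euler polynomials at scale \<open>A * C\<close>,
    \<open>V\<close> the power sums at scale \<open>A * B\<close>; their Cauchy product will be the
    generating function sought.\<close>
  define U where "U = (\<Sum>i=0..a - 1. (-1) ^ i *
    Abs_fps (\<lambda>k. (A * C) ^ k * (euler_poly k (?x i) / fact k)))"
  define V where "V = (\<Sum>i=0..c - 1. (-1) ^ i * fps_exp (of_nat i * (A * B)))"
  have U_nth: "U $ k = (A * C) ^ k * (\<Sum>i=0..a - 1. (-1) ^ i * euler_poly k (?x i)) / fact k" for k
  proof -
    have "((-1) ^ i * Abs_fps (\<lambda>k. (A * C) ^ k * (euler_poly k (?x i) / fact k))) $ k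
        = (A * C) ^ k * ((-1) ^ i * euler_poly k (?x i)) / fact k" for i
      by (cases "even i") simp_all
    then show ?thesis
      by (simp add: U_def fps_sum_nth sum_distrib_left sum_divide_distrib)
  qed
  have V_nth: "V $ k = (A * B) ^ k * alt_power_sum k (c - 1) / fact k" for k
    unfolding V_def by (rule fps_nth_alternating_exp_sum)
  have UV: "Abs_fps (\<lambda>n. weighted_euler_sum n a b c y / fact n) = U * V"
  proof (rule fps_ext)
    fix n
    have "of_nat a ^ n * (of_nat (n choose k) *
        (\<Sum>i=0..a - 1. (-1) ^ i * euler_poly k (?x i)) *
        alt_power_sum (n - k) (c - 1) * of_nat b ^ (n - k) * of_nat c ^ k) / fact n
      = U $ k * V $ (n - k)" if "k \<le> n" for k
    proof -
      \<comment> \<open>The prefactor is shared between the scales \<open>(A * C) ^ k\<close> and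
        \<open>(A * B) ^ (n - k)\<close>.\<close>
      have "A ^ n = A ^ k * A ^ (n - k)"
        using that by (simp flip: power_add)
      then show ?thesis
        using that unfolding U_nth V_nth
        by (simp add: binomial_fact power_mult_distrib A_def B_def C_def)
    qed
    then show "Abs_fps (\<lambda>n. weighted_euler_sum n a b c y / fact n) $ n = (U * V) $ n"
      by (simp add: weighted_euler_sum_def fps_mult_nth sum_distrib_left sum_divide_distrib
          A_def B_def)
  qed
  have "(fps_exp (A * C) + 1) * U = (\<Sum>i=0..a - 1. (-1) ^ i * (2 * fps_exp (A * C * ?x i)))"
    unfolding U_def sum_distrib_left
    by (simp only: mult.left_commute[of "fps_exp (A * C) + 1"]
        euler_poly_generating_function_scaled)
  also have "\<dots> = 2 * fps_exp (A * B * C * y) *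
      (\<Sum>i=0..a - 1. (-1) ^ i * fps_exp (of_nat i * (B * C)))"
  proof -
    \<comment> \<open>The scale \<open>A * C\<close> cancels the denominator of
      \<open>B / A\<close>, so the part with \<open>y\<close> factors out and an alternating
      geometric sum in \<open>fps_exp (B * C)\<close> remains.\<close>
    have "A * C * ?x i = A * B * C * y + of_nat i * (B * C)" for i
      using A by (simp add: field_simps)
    then show ?thesis
      by (simp add: fps_exp_add_mult sum_distrib_left mult_ac)
  qed
  finally have "(fps_exp (B * C) + 1) * ((fps_exp (A * C) + 1) * U)
      = 2 * fps_exp (A * B * C * y) * ((fps_exp (B * C) + 1) *
        (\<Sum>i=0..a - 1. (-1) ^ i * fps_exp (of_nat i * (B * C))))"
    by (simp only: mult_ac)
  also have "\<dots> = 2 * fps_exp (A * B * C * y) * (fps_exp (A * B * C) + 1)"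
    using fps_exp_alternating_sum[OF assms(1), of "B * C"] by (simp add: A_def mult.assoc)
  finally have U: "(fps_exp (B * C) + 1) * ((fps_exp (A * C) + 1) * U)
      = 2 * fps_exp (A * B * C * y) * (fps_exp (A * B * C) + 1)" .
  have V: "(fps_exp (A * B) + 1) * V = fps_exp (A * B * C) + 1"
    using fps_exp_alternating_sum[OF assms(2), of "A * B"] by (simp add: V_def C_def mult_ac)
  have "(fps_exp (B * C) + 1) * (fps_exp (A * C) + 1) * (fps_exp (A * B) + 1) * (U * V)
      = ((fps_exp (B * C) + 1) * ((fps_exp (A * C) + 1) * U)) * ((fps_exp (A * B) + 1) * V)"
    by (simp only: mult_ac)
  then show ?thesis
    unfolding UV U V by (simp only: power2_eq_square mult_ac)
qed

text \<open>The constant coefficient is 2, which is nonzero in characteristic 0.\<close>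

lemma fps_exp_plus_one_nonzero: "fps_exp (s :: 'a::field_char_0) + 1 \<noteq> 0"
proof
  assume "fps_exp s + 1 = 0"
  then have "(fps_exp s + 1) $ 0 = 0 $ 0"
    by (simp only:)
  then show False
    by simp
qed

text \<open>These two adjacent transpositions generate all permutations of the weights.\<close>

lemma weighted_euler_sum_swap:
  fixes y :: "'a::field_char_0"
  assumes "odd a" "odd b" "odd c"
  shows "weighted_euler_sum n a b c y = weighted_euler_sum n b a c y"
    and "weighted_euler_sum n a b c y = weighted_euler_sum n a c b y"
proof -
  let ?P = "\<lambda>s t. fps_exp (of_nat s * of_nat t :: 'a) + 1"
  let ?G = "\<lambda>a b c. Abs_fps (\<lambda>n. weighted_euler_sum n a b c y / fact n)"
  let ?D = "?P b c * ?P a c * ?P a b"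
  have nz: "?D \<noteq> 0"
    by (simp add: fps_exp_plus_one_nonzero)
  \<comment> \<open>The swap only reorders the factors of \<open>?D\<close> and of the common
    right-hand side; \<open>?D\<close> then cancels, as power series over a field form an integral
    domain.\<close>
  have "?D * ?G a b c = ?D * ?G b a c"
    using weighted_euler_sum_generating_function[OF assms(1,3), of b y]
      weighted_euler_sum_generating_function[OF assms(2,3), of a y]
    by (simp only: mult_ac)
  then have "?G a b c = ?G b a c"
    by (rule mult_left_cancel[OF nz, THEN iffD1])
  then have "?G a b c $ n = ?G b a c $ n"
    by (rule arg_cong)
  then show "weighted_euler_sum n a b c y = weighted_euler_sum n b a c y"
    by simp
  have "?D * ?G a b c = ?D * ?G a c b"
    using weighted_euler_sum_generating_function[OF assms(1,3), of b y]
      weighted_euler_sum_generating_function[OF assms(1,2), of c y]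
    by (simp only: mult_ac)
  then have "?G a b c = ?G a c b"
    by (rule mult_left_cancel[OF nz, THEN iffD1])
  then have "?G a b c $ n = ?G a c b $ n"
    by (rule arg_cong)
  then show "weighted_euler_sum n a b c y = weighted_euler_sum n a c b y"
    by simp
qed

theorem theorem11:
  fixes w1 w2 w3 n :: nat and y1 :: "'a::field_char_0"
  assumes "0 < w1" "odd w1" and "0 < w2" "odd w2" and "0 < w3" "odd w3"
  shows "let
      A1 = of_nat w1 ^ n * (\<Sum>k=0..n. of_nat (n choose k) *
         (\<Sum>i=0..w1 - 1. (-1) ^ i * euler_poly k (of_nat w2 * y1 + of_nat w2 / of_nat w1 * of_nat i)) *
         alt_power_sum (n - k) (w3 - 1) * of_nat w2 ^ (n - k) * of_nat w3 ^ k);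
      A2 = of_nat w1 ^ n * (\<Sum>k=0..n. of_nat (n choose k) *
         (\<Sum>i=0..w1 - 1. (-1) ^ i * euler_poly k (of_nat w3 * y1 + of_nat w3 / of_nat w1 * of_nat i)) *
         alt_power_sum (n - k) (w2 - 1) * of_nat w3 ^ (n - k) * of_nat w2 ^ k);
      A3 = of_nat w2 ^ n * (\<Sum>k=0..n. of_nat (n choose k) *
         (\<Sum>i=0..w2 - 1. (-1) ^ i * euler_poly k (of_nat w1 * y1 + of_nat w1 / of_nat w2 * of_nat i)) *
         alt_power_sum (n - k) (w3 - 1) * of_nat w1 ^ (n - k) * of_nat w3 ^ k);
      A4 = of_nat w2 ^ n * (\<Sum>k=0..n. of_nat (n choose k) *
         (\<Sum>i=0..w2 - 1. (-1) ^ i * euler_poly k (of_nat w3 * y1 + of_nat w3 / of_nat w2 * of_nat i)) *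
         alt_power_sum (n - k) (w1 - 1) * of_nat w3 ^ (n - k) * of_nat w1 ^ k);
      A5 = of_nat w3 ^ n * (\<Sum>k=0..n. of_nat (n choose k) *
         (\<Sum>i=0..w3 - 1. (-1) ^ i * euler_poly k (of_nat w1 * y1 + of_nat w1 / of_nat w3 * of_nat i)) *
         alt_power_sum (n - k) (w2 - 1) * of_nat w1 ^ (n - k) * of_nat w2 ^ k);
      A6 = of_nat w3 ^ n * (\<Sum>k=0..n. of_nat (n choose k) *
         (\<Sum>i=0..w3 - 1. (-1) ^ i * euler_poly k (of_nat w2 * y1 + of_nat w2 / of_nat w3 * of_nat i)) *
         alt_power_sum (n - k) (w1 - 1) * of_nat w2 ^ (n - k) * of_nat w1 ^ k)
    in A1 = A2 \<and> A2 = A3 \<and> A3 = A4 \<and> A4 = A5 \<and> A5 = A6"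
  \<comment> \<open>After folding, \<open>A1\<close> to \<open>A6\<close> carry the orders 123, 132,
    213, 231, 312, 321 of the weights, all linked by the two swaps.\<close>
  unfolding Let_def weighted_euler_sum_def[symmetric]
  using assms by (metis weighted_euler_sum_swap)

end
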